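(* Let $p\in[0,1]$. If the server has probability $p$ of winning each point, then the game tie-breaker ends (after finitely many points) with probability $1$; that is, $\theta_{GT}^{END}(p)=1$ for every $p\in[0,1]$.
   Context: Game tie-breaker (deuce) in tennis: one player (the server) serves all points. The outcomes $V_1,V_2,\ldots$ are independent Bernoulli random variables with $\Pr\{V_i=1\}=p$, where $V_i=1$ means the server wins the $i$th point and $V_i=0$ means the receiver wins it. Starting from an even score, points are played until one player is ahead by two points for the first time; that player wins the tie-breaker and the tie-breaker ends. $\theta_{GT}^{END}(p)$ denotes the probability that the tie-breaker ends after finitely many points. *)

theory Defs
  imports "HOL-Probability.Probability"
begin

text \<open>
  \<open>V i \<omega>\<close>, for \<open>i \<ge> 1\<close>, is the outcome of the \<open>i\<close>th point: \<open>1\<close> if the server wins it, \<open>0\<close> if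
  the receiver wins it; \<open>V 0\<close> plays no role.  The scores below count the points won since the
  even score at which the tie-breaker starts.
\<close>

definition server_points :: "(nat \<Rightarrow> 'a \<Rightarrow> nat) \<Rightarrow> 'a \<Rightarrow> nat \<Rightarrow> nat" where
  "server_points V \<omega> n = card {i \<in> {1..n}. V i \<omega> = 1}"

definition receiver_points :: "(nat \<Rightarrow> 'a \<Rightarrow> nat) \<Rightarrow> 'a \<Rightarrow> nat \<Rightarrow> nat" where
  "receiver_points V \<omega> n = card {i \<in> {1..n}. V i \<omega> = 0}"

definition two_ahead :: "(nat \<Rightarrow> 'a \<Rightarrow> nat) \<Rightarrow> 'a \<Rightarrow> nat \<Rightarrow> bool" where
  "two_ahead V \<omega> n \<longleftrightarrow>
     server_points V \<omega> n = receiver_points V \<omega> n + 2 \<or>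
     receiver_points V \<omega> n = server_points V \<omega> n + 2"

definition GT_ends_at :: "(nat \<Rightarrow> 'a \<Rightarrow> nat) \<Rightarrow> 'a \<Rightarrow> nat \<Rightarrow> bool" where
  "GT_ends_at V \<omega> n \<longleftrightarrow> two_ahead V \<omega> n \<and> (\<forall>m<n. \<not> two_ahead V \<omega> m)"

definition theta_GT_END :: "'a measure \<Rightarrow> (nat \<Rightarrow> 'a \<Rightarrow> nat) \<Rightarrow> real" where
  "theta_GT_END M V = measure M {\<omega> \<in> space M. \<exists>n. GT_ends_at V \<omega> n}"

end

theory Submission
  imports Defs
begin

text \<open>
  Group the points into the consecutive pairs \<open>(2k + 1, 2k + 2)\<close>.  While every pair is split, one
  point to each player, the score is even after each pair; the first pair won entirely by one
  player therefore puts that player two points ahead.  So a tie-breaker that never ends has all of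
  its pairs split (\<open>pair_split_if_never_two_ahead\<close>).  A pair is split with probability
  \<open>2 p (1 - p) \<le> 1 / 2\<close>, and distinct pairs are independent because they involve disjoint sets of
  points; the first \<open>n\<close> pairs are thus all split with probability
  \<open>(2 p (1 - p)) ^ n \<le> (1 / 2) ^ n\<close> (\<open>prob_pairs_split\<close>).  As \<open>n\<close> is arbitrary, the tie-breaker goes on forever with probability \<open>0\<close>.
  The bound \<open>1 / 2\<close> is uniform in \<open>p\<close>, so the degenerate cases \<open>p = 0\<close> and \<open>p = 1\<close> are covered too.
\<close>

lemma server_points_0 [simp]: "server_points V \<omega> 0 = 0"
  by (simp add: server_points_def)

lemma receiver_points_0 [simp]: "receiver_points V \<omega> 0 = 0"
  by (simp add: receiver_points_def)

lemma server_points_Suc: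
  "server_points V \<omega> (Suc n) = server_points V \<omega> n + (if V (Suc n) \<omega> = 1 then 1 else 0)"
proof -
  have "{i \<in> {1..Suc n}. V i \<omega> = 1} =
      (if V (Suc n) \<omega> = 1 then insert (Suc n) {i \<in> {1..n}. V i \<omega> = 1} else {i \<in> {1..n}. V i \<omega> = 1})"
    by (auto simp: le_Suc_eq)
  then show ?thesis by (simp add: server_points_def)
qed

lemma receiver_points_Suc:
  "receiver_points V \<omega> (Suc n) = receiver_points V \<omega> n + (if V (Suc n) \<omega> = 0 then 1 else 0)"
proof -
  have "{i \<in> {1..Suc n}. V i \<omega> = 0} =
      (if V (Suc n) \<omega> = 0 then insert (Suc n) {i \<in> {1..n}. V i \<omega> = 0} else {i \<in> {1..n}. V i \<omega> = 0})"
    by (auto simp: le_Suc_eq)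
  then show ?thesis by (simp add: receiver_points_def)
qed

lemma ex_GT_ends_at_iff: "(\<exists>n. GT_ends_at V \<omega> n) \<longleftrightarrow> (\<exists>n. two_ahead V \<omega> n)"
  unfolding GT_ends_at_def using exists_least_iff[of "two_ahead V \<omega>"] by blast

text \<open>
  Points are counted from \<open>1\<close> but pairs from \<open>0\<close>, so pair \<open>k\<close> starts when \<open>2 * k\<close> points have been
  played.
\<close>

definition pair_split :: "(nat \<Rightarrow> 'a \<Rightarrow> nat) \<Rightarrow> nat \<Rightarrow> 'a \<Rightarrow> bool" where
  "pair_split V k \<omega> \<longleftrightarrow> V (2 * k + 1) \<omega> \<noteq> V (2 * k + 2) \<omega>"

text \<open>
  If one player won both points of a pair begun at an even score, that player would be two ahead
  at its end.
\<close>

lemma pair_split_if_even_score: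
  assumes "\<And>i. i \<ge> 1 \<Longrightarrow> V i \<omega> \<in> {0, 1}"
    and "\<And>n. \<not> two_ahead V \<omega> n"
    and "server_points V \<omega> (2 * k) = receiver_points V \<omega> (2 * k)"
  shows "pair_split V k \<omega>"
  using assms(1)[of "2 * k + 1"] assms(1)[of "2 * k + 2"] assms(2)[of "2 * k + 2"] assms(3)
  by (auto simp: pair_split_def two_ahead_def server_points_Suc receiver_points_Suc)

text \<open>
  By induction the score is even before each pair: a split pair preserves it.
\<close>

lemma pair_split_if_never_two_ahead:
  assumes outcome: "\<And>i. i \<ge> 1 \<Longrightarrow> V i \<omega> \<in> {0, 1}"
    and never: "\<And>n. \<not> two_ahead V \<omega> n"
  shows "pair_split V k \<omega>"
proof -
  have "server_points V \<omega> (2 * k) = receiver_points V \<omega> (2 * k)"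
  proof (induction k)
    case (Suc k)
    have "pair_split V k \<omega>"
      by (rule pair_split_if_even_score[OF outcome never Suc.IH])
    then show ?case
      using Suc.IH outcome[of "2 * k + 1"] outcome[of "2 * k + 2"]
      by (auto simp: pair_split_def server_points_Suc receiver_points_Suc)
  qed simp
  then show ?thesis
    using pair_split_if_even_score[of V \<omega> k] outcome never by blast
qed

text \<open>
  The pairs use disjoint blocks of the independent outcomes, and whether a pair is split is a
  function of its own block.
\<close>

lemma (in prob_space) indep_vars_pair_split:
  assumes "indep_vars (\<lambda>_. count_space UNIV) V {1..}"
  shows "indep_vars (\<lambda>_. count_space UNIV) (pair_split V) UNIV"
proof -
  let ?K = "\<lambda>k::nat. {2 * k + 1, 2 * k + 2}"
  have "disjoint_family_on ?K UNIV"
    by (auto simp: disjoint_family_on_def)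
  then have "indep_vars (\<lambda>k. PiM (?K k) (\<lambda>_. count_space UNIV))
      (\<lambda>k \<omega>. restrict (\<lambda>i. V i \<omega>) (?K k)) UNIV"
    by (intro indep_vars_restrict[OF assms]) auto
  then have "indep_vars (\<lambda>_. count_space UNIV)
      (\<lambda>k \<omega>. restrict (\<lambda>i. V i \<omega>) (?K k) (2 * k + 1) \<noteq> restrict (\<lambda>i. V i \<omega>) (?K k) (2 * k + 2)) UNIV"
    by (rule indep_vars_compose2) measurable
  then show ?thesis
    by (simp add: pair_split_def[abs_def])
qed

lemma (in prob_space) prob_two_outcomes:
  assumes "indep_vars (\<lambda>_. count_space UNIV) V {1::nat..}"
    and "1 \<le> i" "1 \<le> j" "i \<noteq> j"
  shows "prob {\<omega> \<in> space M. V i \<omega> = a \<and> V j \<omega> = b} =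
    prob {\<omega> \<in> space M. V i \<omega> = a} * prob {\<omega> \<in> space M. V j \<omega> = b}"
proof -
  let ?A = "\<lambda>l. if l = i then {a} else {b}"
  have "prob (\<Inter>l\<in>{i, j}. V l -` ?A l \<inter> space M) = (\<Prod>l\<in>{i, j}. prob (V l -` ?A l \<inter> space M))"
    by (rule indep_varsD[OF assms(1)]) (use assms in auto)
  moreover have "(\<Inter>l\<in>{i, j}. V l -` ?A l \<inter> space M) = {\<omega> \<in> space M. V i \<omega> = a \<and> V j \<omega> = b}"
    "V i -` {a} \<inter> space M = {\<omega> \<in> space M. V i \<omega> = a}"
    "V j -` {b} \<inter> space M = {\<omega> \<in> space M. V j \<omega> = b}"
    using assms by auto
  ultimately show ?thesis using assms by simp
qed

text \<open>
  A pair can be split in two disjoint ways, according to who wins its first point, and each has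
  probability \<open>p * (1 - p)\<close>.
\<close>

lemma (in prob_space) prob_pair_split:
  assumes indep: "indep_vars (\<lambda>_. count_space UNIV) V {1..}"
    and outcome: "\<And>i \<omega>. i \<ge> 1 \<Longrightarrow> \<omega> \<in> space M \<Longrightarrow> V i \<omega> \<in> {0, 1}"
    and prob_1: "\<And>i. i \<ge> 1 \<Longrightarrow> prob {\<omega> \<in> space M. V i \<omega> = 1} = p"
  shows "prob {\<omega> \<in> space M. pair_split V k \<omega>} = 2 * p * (1 - p)"
proof -
  let ?i = "2 * k + 1" and ?j = "2 * k + 2"
  have V_meas: "V i \<in> measurable M (count_space UNIV)" if "i \<ge> 1" for i
    using indep that by (auto simp: indep_vars_def)
  have [measurable]: "V ?i \<in> measurable M (count_space UNIV)" "V ?j \<in> measurable M (count_space UNIV)"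
    by (rule V_meas, simp)+
  have prob_0: "prob {\<omega> \<in> space M. V i \<omega> = 0} = 1 - p" if "i \<ge> 1" for i
  proof -
    have [measurable]: "V i \<in> measurable M (count_space UNIV)"
      by (rule V_meas[OF that])
    have "{\<omega> \<in> space M. V i \<omega> = 0} = space M - {\<omega> \<in> space M. V i \<omega> = 1}"
      using outcome[OF that] by fastforce
    moreover have "{\<omega> \<in> space M. V i \<omega> = 1} \<in> events" by measurable
    ultimately show ?thesis using prob_1[OF that] by (simp add: prob_compl)
  qed
  let ?S = "{\<omega> \<in> space M. V ?i \<omega> = 1 \<and> V ?j \<omega> = 0}"
  let ?R = "{\<omega> \<in> space M. V ?i \<omega> = 0 \<and> V ?j \<omega> = 1}"
  have "{\<omega> \<in> space M. pair_split V k \<omega>} = ?S \<union> ?R"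
    using outcome[of ?i] outcome[of ?j] by (fastforce simp: pair_split_def)
  moreover have "?S \<in> events" "?R \<in> events"
    by measurable
  moreover have "?S \<inter> ?R = {}"
    by auto
  ultimately have "prob {\<omega> \<in> space M. pair_split V k \<omega>} = prob ?S + prob ?R"
    using finite_measure_Union[of ?S ?R] by presburger
  also have "\<dots> = p * (1 - p) + (1 - p) * p"
    using prob_two_outcomes[OF indep, of ?i ?j] prob_0[of ?i] prob_0[of ?j] prob_1[of ?i] prob_1[of ?j]
    by simp
  finally show ?thesis by (simp add: algebra_simps)
qed

lemma (in prob_space) prob_pairs_split:
  assumes indep: "indep_vars (\<lambda>_. count_space UNIV) V {1..}"
    and outcome: "\<And>i \<omega>. i \<ge> 1 \<Longrightarrow> \<omega> \<in> space M \<Longrightarrow> V i \<omega> \<in> {0, 1}"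
    and prob_1: "\<And>i. i \<ge> 1 \<Longrightarrow> prob {\<omega> \<in> space M. V i \<omega> = 1} = p"
  shows "prob {\<omega> \<in> space M. \<forall>k\<le>n. pair_split V k \<omega>} = (2 * p * (1 - p)) ^ Suc n"
proof -
  have "prob (\<Inter>k\<in>{..n}. pair_split V k -` {True} \<inter> space M) =
      (\<Prod>k\<le>n. prob (pair_split V k -` {True} \<inter> space M))"
    by (rule indep_varsD[OF indep_vars_pair_split[OF indep]]) auto
  moreover have "(\<Inter>k\<in>{..n}. pair_split V k -` {True} \<inter> space M) =
      {\<omega> \<in> space M. \<forall>k\<le>n. pair_split V k \<omega>}"
    by auto
  moreover have "pair_split V k -` {True} \<inter> space M = {\<omega> \<in> space M. pair_split V k \<omega>}" for k
    by auto
  ultimately show ?thesis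
    by (simp add: prob_pair_split[OF assms])
qed

lemma two_ahead_measurable:
  assumes "\<And>i. i \<ge> 1 \<Longrightarrow> V i \<in> measurable M (count_space UNIV)"
  shows "Measurable.pred M (\<lambda>\<omega>. two_ahead V \<omega> n)"
proof -
  have [measurable]: "(\<lambda>\<omega>. server_points V \<omega> n) \<in> measurable M (count_space UNIV)" for n
  proof (induction n)
    case (Suc n)
    note [measurable] = Suc assms[of "Suc n", simplified]
    show ?case unfolding server_points_Suc by measurable
  qed simp
  have [measurable]: "(\<lambda>\<omega>. receiver_points V \<omega> n) \<in> measurable M (count_space UNIV)" for n
  proof (induction n)
    case (Suc n)
    note [measurable] = Suc assms[of "Suc n", simplified]
    show ?case unfolding receiver_points_Suc by measurable
  qed simp
  \<comment> \<open>Naming the two scores reduces the event to comparisons with constants, combined countably.\<close>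
  have two_ahead_eq: "two_ahead V \<omega> n \<longleftrightarrow> (\<exists>s r. server_points V \<omega> n = s \<and> receiver_points V \<omega> n = r \<and>
      (s = r + 2 \<or> r = s + 2))" for \<omega>
    by (simp add: two_ahead_def)
  show ?thesis
    unfolding two_ahead_eq by measurable
qed

theorem proposition2p1:
  fixes M :: "'a measure" and V :: "nat \<Rightarrow> 'a \<Rightarrow> nat" and p :: real
  assumes "p \<in> {0..1}"
    and "prob_space M"
    and "prob_space.indep_vars M (\<lambda>_. count_space UNIV) V {1..}"
    and "\<And>i \<omega>. i \<ge> 1 \<Longrightarrow> \<omega> \<in> space M \<Longrightarrow> V i \<omega> \<in> {0, 1}"
    and "\<And>i. i \<ge> 1 \<Longrightarrow> measure M {\<omega> \<in> space M. V i \<omega> = 1} = p"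
  shows "theta_GT_END M V = 1"
proof -
  interpret prob_space M by fact
  let ?q = "2 * p * (1 - p)"
  let ?End = "{\<omega> \<in> space M. \<exists>n. two_ahead V \<omega> n}"
  have V_meas: "V i \<in> measurable M (count_space UNIV)" if "i \<ge> 1" for i
    using assms(3) that by (auto simp: indep_vars_def)
  note [measurable] = two_ahead_measurable[of V M, OF V_meas]
  have End_meas: "?End \<in> events"
    by measurable
  have split_meas: "{\<omega> \<in> space M. \<forall>k\<le>n. pair_split V k \<omega>} \<in> events" for n
  proof -
    have [measurable]: "pair_split V k \<in> measurable M (count_space UNIV)" for k
      using indep_vars_pair_split[OF assms(3)] by (auto simp: indep_vars_def)
    show ?thesis by measurable
  qed
  have bound: "prob (space M - ?End) \<le> ?q ^ Suc n" for n
  proof -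
    have "space M - ?End \<subseteq> {\<omega> \<in> space M. \<forall>k\<le>n. pair_split V k \<omega>}"
      using pair_split_if_never_two_ahead[of V] assms(4) by blast
    then have "prob (space M - ?End) \<le> prob {\<omega> \<in> space M. \<forall>k\<le>n. pair_split V k \<omega>}"
      by (intro finite_measure_mono split_meas)
    also have "\<dots> = ?q ^ Suc n"
      by (rule prob_pairs_split[OF assms(3,4,5)])
    finally show ?thesis .
  qed
  have "0 \<le> ?q" using assms(1) by simp
  moreover have "?q \<le> 1 / 2"
    \<comment> \<open>\<open>1 - 4 p (1 - p) = (2 p - 1)\<^sup>2\<close>\<close>
    using zero_le_power2[of "2 * p - 1"] by (simp add: power2_eq_square algebra_simps)
  ultimately have "(\<lambda>n. ?q ^ Suc n) \<longlonglongrightarrow> 0"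
    by (intro LIMSEQ_Suc LIMSEQ_realpow_zero) auto
  then have "prob (space M - ?End) \<le> 0"
    by (rule LIMSEQ_le_const) (use bound in auto)
  then have "prob ?End = 1"
    using prob_compl[OF End_meas] prob_le_1[of ?End] by linarith
  then show ?thesis
    by (simp add: theta_GT_END_def ex_GT_ends_at_iff)
qed

end
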